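(* Let $X,Y$ be indeterminates, $b_k=2k+X+Y$ for $k\ge0$ and $\lambda_k=(k+X)(k-1+Y)$ for $k\ge1$. Then for every $n\ge0$, \[ \mu_n(b_k,\lambda_k)=\sum_{T\in\mathrm{PT}_{n+1}}X^{\mathrm{urr}(T)-1}Y^{\mathrm{urc}(T)} . \]
   Context: For sequences $(b_k)_{k\ge0}$, $(\lambda_k)_{k\ge1}$ let $p_n$ be the monic polynomials with $p_{-1}=0$, $p_0=1$, $p_{n+1}=(x-b_n)p_n-\lambda_np_{n-1}$; $\mu_n(b_k,\lambda_k)$ denotes $\mathcal L(x^n)$, where $\mathcal L$ is the unique linear functional on polynomials with $\mathcal L(1)=1$ and $\mathcal L(p_m)=0$ for all $m\ge1$. A permutation tableau is a filling of a Ferrers diagram (empty rows allowed) with 0's and 1's such that every column contains at least one 1, and no 0 has both a 1 above it in its column and a 1 to its left in its row. Its length is the number of rows plus the number of columns; $\mathrm{PT}_n$ is the set of permutation tableaux of length $n$. A 0 is restricted if it has a 1 above it in the same column; a row is unrestricted if it contains no restricted 0, and $\mathrm{urr}(T)$ is the number of unrestricted rows. A 0 is c-restricted if it has a 1 to its left in the same row; a column is unrestricted if it contains no c-restricted 0, and $\mathrm{urc}(T)$ is the number of unrestricted columns. *)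

theory Defs
  imports "HOL-Computational_Algebra.Polynomial"
begin

text \<open>The value \<open>lam 0\<close> is never used: it would only occur multiplied by $p_{-1} = 0$.\<close>

fun orth_poly :: "(nat \<Rightarrow> 'a::comm_ring_1) \<Rightarrow> (nat \<Rightarrow> 'a) \<Rightarrow> nat \<Rightarrow> 'a poly" where
  "orth_poly b lam 0 = 1"
| "orth_poly b lam (Suc 0) = [:- b 0, 1:]"
| "orth_poly b lam (Suc (Suc n)) =
     [:- b (Suc n), 1:] * orth_poly b lam (Suc n) - smult (lam (Suc n)) (orth_poly b lam n)"

definition is_moment_functional ::
    "(nat \<Rightarrow> 'a::comm_ring_1) \<Rightarrow> (nat \<Rightarrow> 'a) \<Rightarrow> ('a poly \<Rightarrow> 'a) \<Rightarrow> bool" where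
  "is_moment_functional b lam L \<longleftrightarrow>
     module_hom smult (*) L \<and> L 1 = 1 \<and> (\<forall>m\<ge>1. L (orth_poly b lam m) = 0)"

definition moment_functional ::
    "(nat \<Rightarrow> 'a::comm_ring_1) \<Rightarrow> (nat \<Rightarrow> 'a) \<Rightarrow> 'a poly \<Rightarrow> 'a" where
  "moment_functional b lam = (THE L. is_moment_functional b lam L)"

definition moment :: "(nat \<Rightarrow> 'a::comm_ring_1) \<Rightarrow> (nat \<Rightarrow> 'a) \<Rightarrow> nat \<Rightarrow> 'a" where
  "moment b lam n = moment_functional b lam (monom 1 n)"

lemma orth_poly_monic:
  "coeff (orth_poly b lam n) n = 1 \<and> degree (orth_poly b lam n) \<le> n"
proof (induction b lam n rule: orth_poly.induct)
  case (3 b lam n)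
  let ?p = "orth_poly b lam (Suc n)" and ?q = "orth_poly b lam n"
  have eq: "orth_poly b lam (Suc (Suc n)) =
      smult (- b (Suc n)) ?p + pCons 0 ?p - smult (lam (Suc n)) ?q"
    by simp
  have z: "coeff ?p i = 0" if "i > Suc n" for i
    using 3 that by (meson coeff_eq_0 le_less_trans)
  have zq: "coeff ?q i = 0" if "i > n" for i
    using 3 that by (meson coeff_eq_0 le_less_trans)
  show ?case
    unfolding eq using 3(1)
    by (auto intro!: degree_le simp: z zq coeff_pCons split: nat.splits)
qed auto

lemma orth_poly_expand:
  "orth_poly b lam n = monom 1 n + (\<Sum>i<n. smult (coeff (orth_poly b lam n) i) (monom 1 i))"
proof -
  have "orth_poly b lam n = (\<Sum>i\<le>n. monom (coeff (orth_poly b lam n) i) i)"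
    using poly_as_sum_of_monoms'[of "orth_poly b lam n" n] orth_poly_monic[of b lam n] by simp
  also have "\<dots> = monom 1 n + (\<Sum>i<n. monom (coeff (orth_poly b lam n) i) i)"
    using orth_poly_monic[of b lam n]
    by (simp add: lessThan_Suc_atMost[symmetric] add.commute)
  finally show ?thesis by (simp add: smult_monom)
qed

fun moment_rec :: "(nat \<Rightarrow> 'a::comm_ring_1) \<Rightarrow> (nat \<Rightarrow> 'a) \<Rightarrow> nat \<Rightarrow> 'a" where
  "moment_rec b lam n =
     (if n = 0 then 1 else - (\<Sum>i<n. coeff (orth_poly b lam n) i * moment_rec b lam i))"

declare moment_rec.simps [simp del]

lemma moment_functional_exists: "\<exists>L. is_moment_functional b lam L"
proof -
  let ?m = "moment_rec b lam"
  define L where "L q = (\<Sum>i\<le>degree q. coeff q i * ?m i)" for q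
  have L: "L q = (\<Sum>i\<le>N. coeff q i * ?m i)" if "degree q \<le> N" for q N
    unfolding L_def using that
    by (intro sum.mono_neutral_left) (auto simp: coeff_eq_0)
  have add: "L (p + q) = L p + L q" for p q
  proof -
    define N where "N = max (degree p) (degree q)"
    have "degree p \<le> N" "degree q \<le> N" "degree (p + q) \<le> N"
      by (auto simp: N_def degree_add_le_max)
    then show ?thesis by (simp add: L[of _ N] sum.distrib algebra_simps)
  qed
  have scale: "L (smult c p) = c * L p" for c p
    using L[of "smult c p" "degree p"] L[of p "degree p"]
    by (simp add: degree_smult_le sum_distrib_left mult.assoc)
  have hom: "module_hom smult (*) L"
    by unfold_locales (simp_all add: add scale algebra_simps smult_add_left smult_add_right)
  have one: "L 1 = 1"
    by (simp add: L_def moment_rec.simps)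
  have zero: "L (orth_poly b lam m) = 0" if "m \<ge> 1" for m
  proof -
    have "L (orth_poly b lam m) = (\<Sum>i\<le>m. coeff (orth_poly b lam m) i * ?m i)"
      by (rule L) (simp add: orth_poly_monic)
    also have "\<dots> = (\<Sum>i<m. coeff (orth_poly b lam m) i * ?m i) + ?m m"
      by (simp add: lessThan_Suc_atMost[symmetric] orth_poly_monic)
    finally show ?thesis using that by (simp add: moment_rec.simps[of b lam m])
  qed
  show ?thesis using hom one zero unfolding is_moment_functional_def by blast
qed

lemma moment_functional_determined:
  assumes "is_moment_functional b lam L"
  shows "L (monom 1 n) = moment_rec b lam n"
proof (induction n rule: less_induct)
  case (less n)
  interpret module_hom smult "(*)" L
    using assms by (simp add: is_moment_functional_def)
  show ?case
  proof (cases "n = 0")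
    case True
    then show ?thesis using assms
      by (simp add: is_moment_functional_def moment_rec.simps monom_0 flip: one_pCons)
  next
    case False
    have "L (orth_poly b lam n) = 0"
      using assms False by (simp add: is_moment_functional_def)
    then have "L (monom 1 n) + (\<Sum>i<n. coeff (orth_poly b lam n) i * L (monom 1 i)) = 0"
      by (subst (asm) orth_poly_expand) (simp add: add sum scale)
    then show ?thesis using False less
      by (simp add: moment_rec.simps[of b lam n] eq_neg_iff_add_eq_0)
  qed
qed

lemma moment_functional_unique:
  assumes "is_moment_functional b lam L" "is_moment_functional b lam L'"
  shows "L = L'"
proof
  fix q
  have *: "M q = (\<Sum>i\<le>degree q. coeff q i * moment_rec b lam i)"
    if "is_moment_functional b lam M" for M
  proof -
    interpret module_hom smult "(*)" M
      using that by (simp add: is_moment_functional_def)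
    have "q = (\<Sum>i\<le>degree q. smult (coeff q i) (monom 1 i))"
      using poly_as_sum_of_monoms[of q] by (simp add: smult_monom)
    then have "M q = M (\<Sum>i\<le>degree q. smult (coeff q i) (monom 1 i))" by simp
    also have "\<dots> = (\<Sum>i\<le>degree q. coeff q i * moment_rec b lam i)"
      by (simp only: sum scale moment_functional_determined[OF that])
    finally show ?thesis .
  qed
  show "L q = L' q" using *[OF assms(1)] *[OF assms(2)] by simp
qed

lemma moment_functional: "is_moment_functional b lam (moment_functional b lam)"
  unfolding moment_functional_def
  using moment_functional_exists moment_functional_unique by (metis theI)

text \<open>
  A filling is the list of its rows from top to bottom, \<open>True\<close> standing for 1 and \<open>False\<close> for 0.
  Its shape is a Ferrers diagram iff the row lengths decrease weakly; rows may be empty, and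
  the number of columns is the length of the first row. (Empty columns need not be
  represented, as every column of a permutation tableau has to contain a 1.)
\<close>

type_synonym filling = "bool list list"

definition ferrers_shape :: "filling \<Rightarrow> bool" where
  "ferrers_shape T \<longleftrightarrow> sorted_wrt (\<ge>) (map length T)"

definition num_rows :: "filling \<Rightarrow> nat" where
  "num_rows T = length T"

definition num_cols :: "filling \<Rightarrow> nat" where
  "num_cols T = (if T = [] then 0 else length (hd T))"

definition has_one :: "filling \<Rightarrow> nat \<Rightarrow> nat \<Rightarrow> bool" where
  "has_one T i j \<longleftrightarrow> i < length T \<and> j < length (T ! i) \<and> T ! i ! j"

definition has_zero :: "filling \<Rightarrow> nat \<Rightarrow> nat \<Rightarrow> bool" where
  "has_zero T i j \<longleftrightarrow> i < length T \<and> j < length (T ! i) \<and> \<not> T ! i ! j"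

definition restricted_zero :: "filling \<Rightarrow> nat \<Rightarrow> nat \<Rightarrow> bool" where
  "restricted_zero T i j \<longleftrightarrow> has_zero T i j \<and> (\<exists>i'<i. has_one T i' j)"

definition c_restricted_zero :: "filling \<Rightarrow> nat \<Rightarrow> nat \<Rightarrow> bool" where
  "c_restricted_zero T i j \<longleftrightarrow> has_zero T i j \<and> (\<exists>j'<j. has_one T i j')"

definition permutation_tableau :: "filling \<Rightarrow> bool" where
  "permutation_tableau T \<longleftrightarrow>
     ferrers_shape T \<and>
     (\<forall>j<num_cols T. \<exists>i. has_one T i j) \<and>
     (\<forall>i j. has_zero T i j \<longrightarrow> \<not> ((\<exists>i'<i. has_one T i' j) \<and> (\<exists>j'<j. has_one T i j')))"

definition PT :: "nat \<Rightarrow> filling set" where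
  "PT n = {T. permutation_tableau T \<and> num_rows T + num_cols T = n}"

definition urr :: "filling \<Rightarrow> nat" where
  "urr T = card {i. i < num_rows T \<and> (\<forall>j. \<not> restricted_zero T i j)}"

definition urc :: "filling \<Rightarrow> nat" where
  "urc T = card {j. j < num_cols T \<and> (\<forall>i. \<not> c_restricted_zero T i j)}"

lemma finite_PT: "finite (PT n)"
proof (rule finite_subset)
  let ?R = "{r :: bool list. set r \<subseteq> UNIV \<and> length r \<le> n}"
  show "PT n \<subseteq> {T. set T \<subseteq> ?R \<and> length T \<le> n}"
  proof
    fix T assume T: "T \<in> PT n"
    have "length r \<le> n" if "r \<in> set T" for r
      using T that
      by (cases T) (auto simp: PT_def permutation_tableau_def ferrers_shape_def
          num_rows_def num_cols_def)
    then show "T \<in> {T. set T \<subseteq> ?R \<and> length T \<le> n}"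
      using T by (auto simp: PT_def num_rows_def)
  qed
  have "finite ?R" by (rule finite_lists_length_le) simp
  then show "finite {T. set T \<subseteq> ?R \<and> length T \<le> n}"
    by (rule finite_lists_length_le)
qed

text \<open>The top row is always unrestricted, so \<open>urr T - 1\<close> is never a truncated subtraction.\<close>

lemma urr_pos:
  assumes "T \<in> PT (Suc n)"
  shows "urr T \<ge> 1"
proof -
  have "T \<noteq> []" using assms by (auto simp: PT_def num_rows_def num_cols_def)
  then have "0 \<in> {i. i < num_rows T \<and> (\<forall>j. \<not> restricted_zero T i j)}"
    by (simp add: num_rows_def restricted_zero_def)
  then show ?thesis
    unfolding urr_def by (auto simp: Suc_le_eq card_gt_0_iff)
qed

end

theory Submission
  imports Defs
begin

text \<open>
  Build a tableau along its border from north-east to south-west, each step appending either an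
  empty bottom row or a new leftmost column. A new column can have 1s only in unrestricted rows;
  the unrestricted rows below its topmost 1 stay unrestricted exactly when they receive a 1, and
  an older unrestricted column stays unrestricted exactly when its topmost 1 is not below that
  of the new column. Encoding the tableau by a suitable polynomial in a variable \<open>w\<close>, whose
  value at \<open>w = 0\<close> is \<open>X\<^bsup>urr\<^esup> Y\<^bsup>urc\<^esup>\<close>, one growth step becomes the linear operator
  \<open>M (a + w s(w)) = (w + X) (a + (w + Y) s(w + 1))\<close>. On the polynomials
  \<open>(w + X) w (w - 1) \<dots> (w - k + 1)\<close> this operator is tridiagonal with coefficients
  \<open>1, b\<^sub>k, \<lambda>\<^sub>k\<close>, and all of them except the one with \<open>k = 0\<close> vanish at \<open>w = 0\<close>.
\<close>

subsection \<open>Moments from a tridiagonal operator\<close>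

text \<open>Sending \<open>orth_poly b lam k\<close> to \<open>h k\<close> turns multiplication by
  the variable into \<open>M\<close>, since both obey the same three-term recurrence. Evaluation at
  0 kills \<open>h (Suc k)\<close> just as the moment functional kills the later orthogonal
  polynomials, so the two functionals agree up to the normalisation
  \<open>poly (h 0) 0\<close>.\<close>

lemma moment_functional_mult_monom:
  fixes M :: "'a::comm_ring_1 poly \<Rightarrow> 'a poly"
  assumes M: "module_hom smult smult M"
    and M0: "M (h 0) = h 1 + smult (b 0) (h 0)"
    and MSuc: "\<And>k. M (h (Suc k)) =
      h (Suc (Suc k)) + smult (b (Suc k)) (h (Suc k)) + smult (lam (Suc k)) (h k)"
    and h: "\<And>k. poly (h (Suc k)) 0 = 0"
  shows "moment_functional b lam (monom 1 n * orth_poly b lam k) * poly (h 0) 0 =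
    poly ((M ^^ n) (h k)) 0"
proof (induction n arbitrary: k)
  let ?L = "moment_functional b lam" and ?p = "orth_poly b lam"
  have L: "is_moment_functional b lam ?L"
    by (rule moment_functional)
  {
    case 0
    show ?case
      using L h by (cases k) (auto simp: is_moment_functional_def monom_0 simp flip: one_pCons)
  next
    case (Suc n)
    interpret L: module_hom smult "(*)" ?L
      using L by (simp add: is_moment_functional_def)
    interpret M: module_hom smult smult M
      by (rule M)
    have add: "(M ^^ n) (p + q) = (M ^^ n) p + (M ^^ n) q" for p q
      by (induction n) (simp_all add: M.add)
    have scale: "(M ^^ n) (smult c p) = smult c ((M ^^ n) p)" for c p
      by (induction n) (simp_all add: M.scale)
    \<comment> \<open>The innermost \<open>M\<close> is split off, so that the recurrence acts on
      \<open>h k\<close> first and the induction hypothesis then applies at the neighbouring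
      indices.\<close>
    have Mn: "(M ^^ Suc n) p = (M ^^ n) (M p)" for p
      by (simp add: funpow_swap1)
    have x: "monom 1 (Suc n) * q = monom 1 n * pCons 0 q" for q :: "'a poly"
      by (simp add: monom_Suc)
    show ?case
    proof (cases k)
      case 0
      have "pCons 0 (?p 0) = ?p 1 + smult (b 0) (?p 0)"
        by (simp add: one_pCons)
      then have "monom 1 (Suc n) * ?p 0 = monom 1 n * ?p 1 + smult (b 0) (monom 1 n * ?p 0)"
        by (simp only: x distrib_left mult_smult_right)
      then have "?L (monom 1 (Suc n) * ?p 0) =
          ?L (monom 1 n * ?p 1) + b 0 * ?L (monom 1 n * ?p 0)"
        by (simp only: L.add L.scale)
      then show ?thesis
        unfolding 0 Mn M0 add scale
        by (simp only: distrib_right mult.assoc Suc.IH poly_add poly_smult)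
    next
      case (Suc m)
      have "pCons 0 (?p (Suc m)) =
          ?p (Suc (Suc m)) + smult (b (Suc m)) (?p (Suc m)) + smult (lam (Suc m)) (?p m)"
        by simp
      then have "monom 1 (Suc n) * ?p (Suc m) = monom 1 n * ?p (Suc (Suc m)) +
          smult (b (Suc m)) (monom 1 n * ?p (Suc m)) + smult (lam (Suc m)) (monom 1 n * ?p m)"
        by (simp only: x distrib_left mult_smult_right)
      then have "?L (monom 1 (Suc n) * ?p (Suc m)) = ?L (monom 1 n * ?p (Suc (Suc m))) +
          b (Suc m) * ?L (monom 1 n * ?p (Suc m)) + lam (Suc m) * ?L (monom 1 n * ?p m)"
        by (simp only: L.add L.scale)
      then show ?thesis
        unfolding Suc Mn MSuc add scale
        by (simp only: distrib_right mult.assoc Suc.IH poly_add poly_smult)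
    qed
  }
qed

subsection \<open>The growth operator\<close>

text \<open>\<open>poly_shift 1 p\<close> is the quotient of \<open>p - p(0)\<close> by the
  variable, so no division is required over a general commutative ring.\<close>

definition growth_op :: "'a::comm_ring_1 \<Rightarrow> 'a \<Rightarrow> 'a poly \<Rightarrow> 'a poly" where
  "growth_op X Y p =
     [:X, 1:] * ([:poly p 0:] + [:Y, 1:] * pcompose (poly_shift 1 p) [:1, 1:])"

lemma poly_shift_1_pCons: "poly_shift 1 (pCons a p) = p"
  by (rule poly_eqI) (simp add: coeff_poly_shift)

lemma growth_op_pCons:
  "growth_op X Y (pCons a p) = [:X, 1:] * ([:a:] + [:Y, 1:] * pcompose p [:1, 1:])"
  by (simp only: growth_op_def poly_shift_1_pCons) simp

lemma growth_op_add: "growth_op X Y (p + q) = growth_op X Y p + growth_op X Y q"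
proof -
  have "poly_shift 1 (p + q) = poly_shift 1 p + poly_shift 1 q"
    by (rule poly_eqI) (simp add: coeff_poly_shift)
  moreover have "[:poly (p + q) 0:] = [:poly p 0:] + [:poly q 0:]"
    by simp
  ultimately show ?thesis
    by (simp only: growth_op_def pcompose_add distrib_left ac_simps)
qed

lemma growth_op_smult: "growth_op X Y (smult c p) = smult c (growth_op X Y p)"
  by (cases p) (simp add: growth_op_pCons pcompose_smult algebra_simps smult_add_right)

lemma module_hom_growth_op: "module_hom smult smult (growth_op X Y)"
  by unfold_locales
    (simp_all add: growth_op_add growth_op_smult smult_add_left smult_add_right)

text \<open>The shift of the variable by 1 turns the factor \<open>[:X, 1:]\<close> into
  \<open>[:X + 1, 1:]\<close>. The correction arises because the constant term of \<open>p\<close>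
  is exempt from the shift and from the factor \<open>[:Y, 1:]\<close>, but meets both in the
  product. This relation drives the later induction over rows.\<close>

lemma growth_op_mult:
  "growth_op X Y ([:X, 1:] * p) =
     [:X + 1, 1:] * growth_op X Y p + smult ((Y - 1) * poly p 0) [:X, 1:]"
proof (cases p)
  case (pCons a q)
  have lin: "[:c, 1:] = [:c:] + [:0, 1:]" for c :: 'a
    by simp
  have sm: "smult c r = [:c:] * r" for c and r :: "'a poly"
    by simp
  have con: "[:c * d:] = [:c:] * [:d:]" "[:c + d:] = [:c:] + [:d:]" "[:c - d:] = [:c:] - [:d:]"
    "[:1:] = 1" for c d :: 'a
    by (simp_all add: one_pCons)
  \<comment> \<open>Here \<open>d\<close> stands for the constant \<open>a\<close>, \<open>s\<close>
    for the shifted \<open>q\<close>, and \<open>w\<close> for the polynomial variable.\<close>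
  have ring: "(x + w) * (x * d + (y + w) * (x * s + (d + (1 + w) * s))) =
      (x + 1 + w) * ((x + w) * (d + (y + w) * s)) + (y - 1) * d * (x + w)"
    for x y d s w :: "'a poly"
    by (simp add: algebra_simps)
  have "[:X, 1:] * p = pCons (X * a) (smult X q + p)"
    by (simp add: pCons)
  moreover have "pcompose p [:1, 1:] = [:a:] + [:1, 1:] * pcompose q [:1, 1:]"
    by (simp add: pCons pcompose_pCons)
  moreover have "poly p 0 = a"
    by (simp add: pCons)
  ultimately have "growth_op X Y ([:X, 1:] * p) = [:X, 1:] * ([:X * a:] +
      [:Y, 1:] * (smult X (pcompose q [:1, 1:]) + ([:a:] + [:1, 1:] * pcompose q [:1, 1:])))"
    by (simp only: growth_op_pCons pcompose_add pcompose_smult)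
  also have "\<dots> = [:X + 1, 1:] * ([:X, 1:] * ([:a:] + [:Y, 1:] * pcompose q [:1, 1:]))
      + smult ((Y - 1) * a) [:X, 1:]"
    unfolding lin[of X] lin[of Y] lin[of 1] lin[of "X + 1"] unfolding sm con by (rule ring)
  finally show ?thesis
    by (simp only: growth_op_pCons pCons) simp
qed

text \<open>A falling factorial in the variable times \<open>[:X, 1:]\<close>. The extra factor is
  present in every value of \<open>growth_op\<close>; in particular \<open>growth_basis X 0\<close>
  equals \<open>growth_op X Y 1\<close>.\<close>

definition growth_basis :: "'a::comm_ring_1 \<Rightarrow> nat \<Rightarrow> 'a poly" where
  "growth_basis X k = [:X, 1:] * (\<Prod>i<k. [:- of_nat i, 1:])"

lemma poly_growth_basis_0:
  "poly (growth_basis X 0) 0 = X" "poly (growth_basis X (Suc k)) 0 = 0"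
  by (simp_all add: growth_basis_def poly_prod prod.lessThan_Suc_shift del: prod.lessThan_Suc)

lemma growth_op_basis_0:
  "growth_op X Y (growth_basis X 0) = growth_basis X 1 + smult (X + Y) (growth_basis X 0)"
  by (simp add: growth_basis_def growth_op_pCons algebra_simps)

text \<open>Dividing by the variable \<open>w\<close> and shifting gives
  \<open>(w + X) (w + Y) (w + X + 1) F\<close>, with \<open>F\<close> the falling factorial of
  length \<open>k\<close>. The claim expands \<open>(w + Y) (w + X + 1)\<close> in \<open>1\<close>,
  \<open>w - k\<close> and \<open>(w - k) (w - k - 1)\<close>.\<close>

lemma growth_op_basis_Suc:
  "growth_op X Y (growth_basis X (Suc k)) =
     growth_basis X (Suc (Suc k)) + smult (2 * of_nat (Suc k) + X + Y) (growth_basis X (Suc k)) +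
     smult ((of_nat (Suc k) + X) * (of_nat (Suc k) - 1 + Y)) (growth_basis X k)"
proof -
  define F :: "'a poly" where "F = (\<Prod>i<k. [:- of_nat i, 1:])"
  have lin: "[:c, 1:] = [:c:] + [:0, 1:]" for c :: 'a
    by simp
  have sm: "smult c r = [:c:] * r" for c and r :: "'a poly"
    by simp
  have con: "[:c * d:] = [:c:] * [:d:]" "[:c + d:] = [:c:] + [:d:]" "[:c - d:] = [:c:] - [:d:]"
    "[:-c:] = -[:c:]" "[:1:] = 1" for c d :: 'a
    by (simp_all add: one_pCons)
  have ring: "(x + w) * ((y + w) * ((x + 1 + w) * f)) =
      (x + w) * (f * (- m + w) * (- (1 + m) + w)) +
      (1 + m + (1 + m) + x + y) * ((x + w) * (f * (- m + w))) +
      (1 + m + x) * (1 + m - 1 + y) * ((x + w) * f)" for x y m f w :: "'a poly"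
    by (simp add: algebra_simps)
  have "pcompose (\<Prod>i<k. [:- of_nat (Suc i), 1:]) [:1, 1:] = F"
    by (simp add: F_def pcompose_prod pcompose_pCons)
  moreover have "growth_basis X (Suc k) = pCons 0 ([:X, 1:] * (\<Prod>i<k. [:- of_nat (Suc i), 1:]))"
    unfolding growth_basis_def prod.lessThan_Suc_shift by (simp add: algebra_simps)
  moreover have "pcompose [:X, 1:] [:1, 1:] = [:X + 1, 1:]"
    by (simp add: pcompose_pCons)
  ultimately have "growth_op X Y (growth_basis X (Suc k)) =
      [:X, 1:] * ([:Y, 1:] * ([:X + 1, 1:] * F))"
    by (simp only: growth_op_pCons pcompose_mult) simp
  also have "\<dots> = [:X, 1:] * (F * [:- of_nat k, 1:] * [:- of_nat (Suc k), 1:]) +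
      smult (2 * of_nat (Suc k) + X + Y) ([:X, 1:] * (F * [:- of_nat k, 1:])) +
      smult ((of_nat (Suc k) + X) * (of_nat (Suc k) - 1 + Y)) ([:X, 1:] * F)"
    unfolding mult_2 of_nat_Suc lin[of X] lin[of Y] lin[of "- of_nat k"] lin[of "X + 1"]
      lin[of "- (1 + of_nat k)"]
    unfolding sm con by (rule ring)
  finally show ?thesis
    by (simp add: growth_basis_def F_def)
qed

subsection \<open>Unrestricted rows and columns\<close>

definition row_free :: "filling \<Rightarrow> nat \<Rightarrow> bool" where
  "row_free T i \<longleftrightarrow> (\<forall>j. \<not> restricted_zero T i j)"

definition col_free :: "filling \<Rightarrow> nat \<Rightarrow> bool" where
  "col_free T j \<longleftrightarrow> (\<forall>i. \<not> c_restricted_zero T i j)"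

definition top_one :: "filling \<Rightarrow> nat \<Rightarrow> nat \<Rightarrow> bool" where
  "top_one T i j \<longleftrightarrow> has_one T i j \<and> (\<forall>i'<i. \<not> has_one T i' j)"

definition free_tops :: "filling \<Rightarrow> nat \<Rightarrow> nat set" where
  "free_tops T i = {j. j < num_cols T \<and> col_free T j \<and> top_one T i j}"

text \<open>This records all that growth depends on: which new columns are allowed, and the state
  they lead to. The number of \<open>Some\<close> entries is \<open>urr T\<close>; for a permutation
  tableau their contents add up to \<open>urc T\<close>.\<close>

definition row_state :: "filling \<Rightarrow> nat option list" where
  "row_state T =
     map (\<lambda>i. if row_free T i then Some (card (free_tops T i)) else None) [0..<length T]"

lemma finite_free_tops [simp]: "finite (free_tops T i)"
  by (simp add: free_tops_def)

lemma has_zero_less: "has_zero T i j \<Longrightarrow> i < length T"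
  by (simp add: has_zero_def)

lemma ferrers_length_mono:
  assumes "ferrers_shape T" "i \<le> i'" "i' < length T"
  shows "length (T ! i') \<le> length (T ! i)"
proof (cases "i = i'")
  case False
  then have "i < i'"
    using assms by simp
  then show ?thesis
    using assms by (auto simp: ferrers_shape_def sorted_wrt_map dest: sorted_wrt_nth_less)
qed simp

lemma ferrers_has_zero_above_top:
  assumes "ferrers_shape T" "top_one T i j" "i' < i"
  shows "has_zero T i' j"
proof -
  have "length (T ! i) \<le> length (T ! i')"
    using assms by (intro ferrers_length_mono) (auto simp: top_one_def has_one_def)
  then show ?thesis
    using assms by (auto simp: top_one_def has_one_def has_zero_def)
qed

text \<open>Suppose row \<open>i\<close> had a restricted 0 in column \<open>l\<close>. If
  \<open>l < j\<close>, the 1 above it makes the 0 of column \<open>j\<close> in that higher row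
  c-restricted; if \<open>j < l\<close>, the 0 has a 1 above and the 1 of column \<open>j\<close> to
  its left.\<close>

lemma row_free_top_one:
  assumes T: "permutation_tableau T" and j: "col_free T j" "top_one T i j"
  shows "row_free T i"
  unfolding row_free_def
proof (intro allI notI)
  fix l assume l: "restricted_zero T i l"
  then obtain i' where i': "i' < i" "has_one T i' l" and z: "has_zero T i l"
    by (auto simp: restricted_zero_def)
  have one: "has_one T i j"
    using j by (simp add: top_one_def)
  consider "l < j" | "l = j" | "j < l"
    by linarith
  then show False
  proof cases
    case 1
    have "has_zero T i' j"
      using T j i' by (intro ferrers_has_zero_above_top) (auto simp: permutation_tableau_def)
    then show False
      using 1 i' j(1) by (auto simp: col_free_def c_restricted_zero_def)
  next
    case 2
    then show False
      using one z by (simp add: has_one_def has_zero_def)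
  next
    case 3
    then show False
      using T z i' one by (auto simp: permutation_tableau_def)
  qed
qed

lemma urr_eq: "urr T = card {i. i < length T \<and> row_free T i}"
  by (simp add: urr_def row_free_def num_rows_def)

text \<open>Every unrestricted column has exactly one topmost 1, and by
  \<open>row_free_top_one\<close> it lies in an unrestricted row.\<close>

lemma urc_eq:
  assumes T: "permutation_tableau T"
  shows "urc T = (\<Sum>i | i < length T \<and> row_free T i. card (free_tops T i))"
proof -
  have "{j. j < num_cols T \<and> col_free T j} =
      (\<Union>i\<in>{i. i < length T \<and> row_free T i}. free_tops T i)"
  proof (intro equalityI subsetI)
    fix j assume j: "j \<in> {j. j < num_cols T \<and> col_free T j}"
    then obtain i where i: "has_one T i j"
      using T by (auto simp: permutation_tableau_def)
    define l where "l = (LEAST i. has_one T i j)"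
    have "top_one T l j"
      unfolding top_one_def l_def using i by (auto intro: LeastI dest: not_less_Least)
    then show "j \<in> (\<Union>i\<in>{i. i < length T \<and> row_free T i}. free_tops T i)"
      using j row_free_top_one[OF T] by (auto simp: free_tops_def top_one_def has_one_def)
  qed (auto simp: free_tops_def)
  moreover have "free_tops T i \<inter> free_tops T i' = {}" if "i \<noteq> i'" for i i'
    using that by (auto simp: free_tops_def top_one_def) (metis linorder_neqE_nat)
  ultimately show ?thesis
    unfolding urc_def by (subst card_UN_disjoint[symmetric]) (auto simp: col_free_def)
qed

subsection \<open>Growing a tableau\<close>

lemma has_one_snoc_Nil [simp]: "has_one (T @ [[]]) i j \<longleftrightarrow> has_one T i j"
  by (auto simp: has_one_def nth_append less_Suc_eq)

lemma has_zero_snoc_Nil [simp]: "has_zero (T @ [[]]) i j \<longleftrightarrow> has_zero T i j"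
  by (auto simp: has_zero_def nth_append less_Suc_eq)

lemma num_cols_snoc_Nil [simp]: "num_cols (T @ [[]]) = num_cols T"
  by (simp add: num_cols_def hd_append)

lemma permutation_tableau_snoc_Nil [simp]:
  "permutation_tableau (T @ [[]]) \<longleftrightarrow> permutation_tableau T"
  by (simp add: permutation_tableau_def ferrers_shape_def sorted_wrt_append)

lemma row_state_snoc_Nil: "row_state (T @ [[]]) = row_state T @ [Some 0]"
proof -
  have "row_free (T @ [[]]) = row_free T" "free_tops (T @ [[]]) = free_tops T"
    by (auto simp: fun_eq_iff row_free_def free_tops_def restricted_zero_def col_free_def
        c_restricted_zero_def top_one_def)
  moreover have "row_free T (length T)" "free_tops T (length T) = {}"
    by (auto simp: row_free_def restricted_zero_def has_zero_def free_tops_def top_one_def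
        has_one_def)
  ultimately show ?thesis
    by (simp add: row_state_def)
qed

section \<open>Prepending a leftmost column to a tableau\<close>

definition add_col :: "bool list \<Rightarrow> filling \<Rightarrow> filling" where
  "add_col c T = map2 (#) c T"

definition col_admissible :: "bool list \<Rightarrow> nat option list \<Rightarrow> bool" where
  "col_admissible c s \<longleftrightarrow> length c = length s \<and> True \<in> set c \<and>
     (\<forall>i<length s. c ! i \<longrightarrow> s ! i \<noteq> None)"

text \<open>The prefix \<open>take i c\<close> excludes row \<open>i\<close>, so the row of the
  topmost 1 falls under the second case and gains the new column. Below it counts drop to 0: a
  column topped there has a 0 in the row of the topmost 1, now with a 1 to its left.\<close>

definition col_update :: "bool list \<Rightarrow> nat option list \<Rightarrow> nat option list" where
  "col_update c s = map (\<lambda>i.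
     if True \<in> set (take i c) then (if c ! i then Some 0 else None)
     else if c ! i then map_option Suc (s ! i) else s ! i) [0..<length s]"

context
  fixes c :: "bool list" and T :: filling
  assumes len: "length c = length T"
begin

lemma length_add_col [simp]: "length (add_col c T) = length T"
  using len by (simp add: add_col_def)

lemma nth_add_col [simp]: "i < length T \<Longrightarrow> add_col c T ! i = c ! i # T ! i"
  using len by (simp add: add_col_def)

lemma map_tl_add_col: "map tl (add_col c T) = T"
  and map_hd_add_col: "map hd (add_col c T) = c"
  using len by (auto intro: nth_equalityI)

lemma has_one_add_col [simp]:
  "has_one (add_col c T) i 0 \<longleftrightarrow> i < length T \<and> c ! i"
  "has_one (add_col c T) i (Suc j) \<longleftrightarrow> has_one T i j"
  by (auto simp: has_one_def)

lemma has_zero_add_col [simp]: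
  "has_zero (add_col c T) i 0 \<longleftrightarrow> i < length T \<and> \<not> c ! i"
  "has_zero (add_col c T) i (Suc j) \<longleftrightarrow> has_zero T i j"
  by (auto simp: has_zero_def)

lemma num_cols_add_col: "T \<noteq> [] \<Longrightarrow> num_cols (add_col c T) = Suc (num_cols T)"
  using nth_add_col[of 0] length_add_col
  by (auto simp: num_cols_def hd_conv_nth simp del: length_add_col nth_add_col)

lemma ferrers_shape_add_col: "ferrers_shape (add_col c T) \<longleftrightarrow> ferrers_shape T"
  by (auto simp: ferrers_shape_def sorted_wrt_map sorted_wrt_iff_nth_less)

lemma row_free_add_col:
  assumes "i < length T"
  shows "row_free (add_col c T) i \<longleftrightarrow> row_free T i \<and> (c ! i \<or> (\<forall>i'<i. \<not> c ! i'))"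
proof -
  have all: "(\<forall>j. P j) \<longleftrightarrow> P 0 \<and> (\<forall>j. P (Suc j))" for P :: "nat \<Rightarrow> bool"
    by (metis not0_implies_Suc)
  show ?thesis
    unfolding row_free_def
    by (subst all) (use assms in \<open>auto simp: restricted_zero_def\<close>)
qed

text \<open>Nothing lies to the left of the new column, and an old column is spoiled exactly by a
  new 1 in a row where it has a 0.\<close>

lemma col_free_add_col:
  "col_free (add_col c T) 0"
  "col_free (add_col c T) (Suc j) \<longleftrightarrow>
     col_free T j \<and> (\<forall>i<length T. c ! i \<longrightarrow> \<not> has_zero T i j)"
proof -
  have "(\<exists>j'<Suc j. P j') \<longleftrightarrow> P 0 \<or> (\<exists>j'<j. P (Suc j'))" for P :: "nat \<Rightarrow> bool" and j
    by (metis not0_implies_Suc Suc_less_eq zero_less_Suc)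
  then show "col_free (add_col c T) (Suc j) \<longleftrightarrow>
     col_free T j \<and> (\<forall>i<length T. c ! i \<longrightarrow> \<not> has_zero T i j)"
    by (auto simp: col_free_def c_restricted_zero_def dest: has_zero_less)
qed (simp add: col_free_def c_restricted_zero_def)

lemma col_admissible_row_state:
  "col_admissible c (row_state T) \<longleftrightarrow>
     True \<in> set c \<and> (\<forall>i<length T. c ! i \<longrightarrow> row_free T i)"
  using len by (auto simp: col_admissible_def row_state_def)

text \<open>The 0s of the new column have nothing to their left. An old 0 acquires a 1 to its left
  when its row receives a 1, and is then allowed only without a 1 above it; hence such rows must be
  unrestricted.\<close>

lemma permutation_tableau_add_col:
  assumes "T \<noteq> []"
  shows "permutation_tableau (add_col c T) \<longleftrightarrow>
    permutation_tableau T \<and> col_admissible c (row_state T)"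
proof -
  have all: "(\<forall>j. P j) \<longleftrightarrow> P 0 \<and> (\<forall>j. P (Suc j))" for P :: "nat \<Rightarrow> bool"
    by (metis not0_implies_Suc)
  have ex: "(\<exists>j'<Suc j. P j') \<longleftrightarrow> P 0 \<or> (\<exists>j'<j. P (Suc j'))" for P :: "nat \<Rightarrow> bool" and j
    by (metis not0_implies_Suc Suc_less_eq zero_less_Suc)
  have cols: "(\<forall>j<num_cols (add_col c T). \<exists>i. has_one (add_col c T) i j) \<longleftrightarrow>
      True \<in> set c \<and> (\<forall>j<num_cols T. \<exists>i. has_one T i j)"
    unfolding num_cols_add_col[OF assms]
    by (subst all) (auto simp: in_set_conv_nth len)
  have zeros: "(\<forall>j. has_zero (add_col c T) i j \<longrightarrow>
        \<not> ((\<exists>i'<i. has_one (add_col c T) i' j) \<and> (\<exists>j'<j. has_one (add_col c T) i j'))) \<longleftrightarrow>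
      (\<forall>j. has_zero T i j \<longrightarrow> \<not> ((\<exists>i'<i. has_one T i' j) \<and> (\<exists>j'<j. has_one T i j'))) \<and>
      (i < length T \<longrightarrow> c ! i \<longrightarrow> row_free T i)" for i
    by (subst all) (auto simp: ex row_free_def restricted_zero_def dest: has_zero_less)
  show ?thesis
    unfolding permutation_tableau_def ferrers_shape_add_col col_admissible_row_state cols zeros
      all_conj_distrib
    by (simp only: conj_ac)
qed

lemma row_state_add_col:
  assumes T: "permutation_tableau T" and adm: "col_admissible c (row_state T)"
  shows "row_state (add_col c T) = col_update c (row_state T)"
proof (rule nth_equalityI)
  fix i assume "i < length (row_state (add_col c T))"
  then have i: "i < length T"
    by (simp add: row_state_def)
  have ne: "T \<noteq> []"
    using i by auto
  have free: "row_free T i'" if "i' < length T" "c ! i'" for i'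
    using adm that by (simp add: col_admissible_row_state)
  have take: "True \<in> set (take i c) \<longleftrightarrow> (\<exists>i'<i. c ! i')"
    using i len by (auto simp: in_set_conv_nth)
  have zero: "top_one (add_col c T) i 0 \<longleftrightarrow> c ! i \<and> (\<forall>i'<i. \<not> c ! i')"
    using i by (auto simp: top_one_def)
  have top: "top_one (add_col c T) i (Suc j) \<longleftrightarrow> top_one T i j" for j
    by (simp add: top_one_def)
  have tops: "free_tops (add_col c T) i = (if c ! i \<and> (\<forall>i'<i. \<not> c ! i') then {0} else {}) \<union>
      Suc ` {j \<in> free_tops T i. \<forall>i'<length T. c ! i' \<longrightarrow> \<not> has_zero T i' j}"
    (is "?A = ?B")
  proof (rule set_eqI)
    fix j show "j \<in> ?A \<longleftrightarrow> j \<in> ?B"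
      by (cases j) (auto simp: free_tops_def num_cols_add_col[OF ne] col_free_add_col top zero)
  qed
  show "row_state (add_col c T) ! i = col_update c (row_state T) ! i"
  proof (cases "\<exists>i'<i. c ! i'")
    case True
    then obtain i' where i': "i' < i" "c ! i'"
      by blast
    \<comment> \<open>Columns topped in row \<open>i\<close> reach up to row \<open>i'\<close> by
      the Ferrers shape, and their 0 there is now c-restricted.\<close>
    have "has_zero T i' j" if "j \<in> free_tops T i" for j
      using that i' T
      by (auto simp: free_tops_def permutation_tableau_def intro: ferrers_has_zero_above_top)
    then have "free_tops (add_col c T) i = {}"
      unfolding tops using True i' i by (auto intro: less_trans)
    then show ?thesis
      using True i free take by (auto simp: row_state_def col_update_def row_free_add_col)
  next
    case False
    \<comment> \<open>Such a 0 would lie below the topmost 1 of column \<open>j\<close>, making row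
      \<open>i'\<close> restricted, although an admissible column has a 1 there.\<close>
    have "\<not> has_zero T i' j" if "j \<in> free_tops T i" "i' < length T" "c ! i'" for i' j
    proof
      assume z: "has_zero T i' j"
      have one: "has_one T i j"
        using that by (simp add: free_tops_def top_one_def)
      then have "i' \<noteq> i"
        using z by (auto simp: has_one_def has_zero_def)
      then have "i < i'"
        using False that by (meson linorder_neqE_nat)
      then show False
        using free[of i'] that z one by (auto simp: row_free_def restricted_zero_def)
    qed
    then have "{j \<in> free_tops T i. \<forall>i'<length T. c ! i' \<longrightarrow> \<not> has_zero T i' j} = free_tops T i"
      by auto
    then have "card (free_tops (add_col c T) i) =
        (if c ! i then Suc (card (free_tops T i)) else card (free_tops T i))"
      unfolding tops using False by (auto simp: card_insert_if card_image)
    then show ?thesis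
      using False i free take by (auto simp: row_state_def col_update_def row_free_add_col)
  qed
qed (simp add: row_state_def col_update_def)

end

section \<open>Recursive decomposition of the tableaux of a given length\<close>

lemma PT_Suc:
  "PT (Suc n) = (\<lambda>T. T @ [[]]) ` PT n \<union>
     (\<lambda>(T, c). add_col c T) ` (SIGMA T:PT n. {c. col_admissible c (row_state T)})"
  (is "_ = ?R \<union> ?C")
proof (intro equalityI subsetI)
  fix T assume T: "T \<in> PT (Suc n)"
  then have ne: "T \<noteq> []"
    by (auto simp: PT_def num_rows_def num_cols_def)
  show "T \<in> ?R \<union> ?C"
  proof (cases "last T = []")
    case True
    then obtain U where eq: "T = U @ [[]]"
      using ne by (metis append_butlast_last_id)
    have "U \<in> PT n"
      using T unfolding eq PT_def by (simp add: num_rows_def)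
    then show ?thesis
      using eq by blast
  next
    case False
    \<comment> \<open>Row lengths decrease weakly, so a nonempty last row makes the leftmost column
      meet every row; it can then be stripped off.\<close>
    have nonempty: "T ! i \<noteq> []" if "i < length T" for i
    proof -
      have "length (T ! (length T - 1)) \<le> length (T ! i)"
        using T that
        by (intro ferrers_length_mono) (auto simp: PT_def permutation_tableau_def)
      then show ?thesis
        using False ne by (auto simp: last_conv_nth)
    qed
    define c U where "c = map hd T" and "U = map tl T"
    have eq: "T = add_col c U"
      by (rule nth_equalityI) (auto simp: c_def U_def add_col_def nonempty)
    have len: "length c = length U" and U: "U \<noteq> []"
      using ne by (auto simp: c_def U_def)
    have "U \<in> PT n" "col_admissible c (row_state U)"
      using T unfolding eq PT_def
      by (auto simp: permutation_tableau_add_col[OF len U] num_rows_def length_add_col[OF len]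
          num_cols_add_col[OF len U])
    then show ?thesis
      using eq by auto
  qed
next
  fix T assume "T \<in> ?R \<union> ?C"
  then show "T \<in> PT (Suc n)"
  proof
    assume "T \<in> ?R"
    then show ?thesis
      by (auto simp: PT_def num_rows_def)
  next
    assume "T \<in> ?C"
    then obtain U c where eq: "T = add_col c U" and U: "U \<in> PT n"
      and adm: "col_admissible c (row_state U)"
      by auto
    then have len: "length c = length U" and ne: "U \<noteq> []"
      by (auto simp: col_admissible_def row_state_def)
    show ?thesis
      using U adm unfolding eq PT_def
      by (auto simp: permutation_tableau_add_col[OF len ne] num_rows_def length_add_col[OF len]
          num_cols_add_col[OF len ne])
  qed
qed

lemma finite_col_admissible: "finite {c. col_admissible c s}"
proof (rule finite_subset)
  show "{c. col_admissible c s} \<subseteq> {c. set c \<subseteq> UNIV \<and> length c = length s}"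
    by (auto simp: col_admissible_def)
  show "finite {c :: bool list. set c \<subseteq> UNIV \<and> length c = length s}"
    by (rule finite_lists_length_eq) simp
qed

text \<open>The last growth step is unique: a column step never leaves an empty row, and heads and
  tails of the rows recover the column and the smaller tableau.\<close>

lemma sum_PT_Suc:
  fixes F :: "filling \<Rightarrow> 'a::comm_monoid_add"
  shows "(\<Sum>T\<in>PT (Suc n). F T) =
    (\<Sum>T\<in>PT n. F (T @ [[]]) + (\<Sum>c | col_admissible c (row_state T). F (add_col c T)))"
proof -
  let ?S = "SIGMA T:PT n. {c. col_admissible c (row_state T)}"
  have len: "length c = length T" if "(T, c) \<in> ?S" for T c
    using that by (auto simp: col_admissible_def row_state_def)
  have inj: "inj_on (\<lambda>(T, c). add_col c T) ?S"
  proof (rule inj_on_inverseI)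
    fix x assume "x \<in> ?S"
    then show "(\<lambda>T. (map tl T, map hd T)) (case x of (T, c) \<Rightarrow> add_col c T) = x"
      using len by (cases x) (simp add: map_tl_add_col map_hd_add_col)
  qed
  have disj: "(\<lambda>T. T @ [[]]) ` PT n \<inter> (\<lambda>(T, c). add_col c T) ` ?S = {}"
  proof -
    have "[] \<notin> set (add_col c T)" for c T
      by (auto simp: add_col_def)
    then have "T @ [[]] \<noteq> add_col c U" for c T U
      by (metis in_set_conv_decomp)
    then show ?thesis
      by auto
  qed
  have "finite ?S"
    by (simp add: finite_PT finite_col_admissible)
  then have "(\<Sum>T\<in>PT (Suc n). F T) = sum F ((\<lambda>T. T @ [[]]) ` PT n) +
      sum F ((\<lambda>(T, c). add_col c T) ` ?S)"
    unfolding PT_Suc using disj by (intro sum.union_disjoint) (simp_all add: finite_PT)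
  also have "sum F ((\<lambda>T. T @ [[]]) ` PT n) = (\<Sum>T\<in>PT n. F (T @ [[]]))"
    by (subst sum.reindex) (simp_all add: inj_on_def)
  also have "sum F ((\<lambda>(T, c). add_col c T) ` ?S) = (\<Sum>(T, c)\<in>?S. F (add_col c T))"
    by (subst sum.reindex[OF inj]) (simp add: case_prod_unfold)
  also have "\<dots> = (\<Sum>T\<in>PT n. \<Sum>c | col_admissible c (row_state T). F (add_col c T))"
    by (subst sum.Sigma) (simp_all add: finite_PT finite_col_admissible)
  finally show ?thesis
    by (simp add: sum.distrib)
qed

subsection \<open>The generating polynomial of a tableau\<close>

lemma col_admissible_Nil [simp]: "\<not> col_admissible c []"
  by (simp add: col_admissible_def)

lemma col_admissible_snoc:
  "col_admissible (c @ [x]) (s @ [y]) \<longleftrightarrow>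
     (x \<longrightarrow> y \<noteq> None) \<and>
     (col_admissible c s \<or> x \<and> c = replicate (length s) False)"
proof -
  have "c = replicate (length s) False \<longleftrightarrow> length c = length s \<and> True \<notin> set c"
    by (metis (full_types) in_set_replicate length_replicate replicate_eqI)
  then show ?thesis
    by (auto simp: col_admissible_def nth_append less_Suc_eq in_set_conv_nth)
qed

text \<open>The update of a row looks only at that row and those above it, so a new bottom row
  leaves the earlier entries as they were.\<close>

lemma col_update_snoc:
  assumes "length c = length s"
  shows "col_update (c @ [x]) (s @ [y]) =
    (if True \<in> set c then col_update c s @ [if x then Some 0 else None]
     else s @ [if x then map_option Suc y else y])"
proof -
  have "c ! i \<longleftrightarrow> False" if "True \<notin> set c" "i < length s" for i
    using that assms by (metis (full_types) nth_mem)
  moreover have "True \<notin> set (take i c)" if "True \<notin> set c" for i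
    using that by (meson in_set_takeD)
  ultimately show ?thesis
    using assms by (auto simp: col_update_def nth_append intro!: nth_equalityI)
qed

lemma sum_col_admissible_snoc_None:
  "(\<Sum>c | col_admissible c (s @ [None]). F (col_update c (s @ [None]))) =
   (\<Sum>c | col_admissible c s. F (col_update c s @ [None]))"
proof (rule sum.reindex_bij_witness[of _ "\<lambda>c. c @ [False]" butlast])
  fix c assume "c \<in> {c. col_admissible c (s @ [None])}"
  moreover from this obtain d x where "c = d @ [x]"
    by (cases c rule: rev_cases) (auto simp: col_admissible_def)
  ultimately have c: "c = d @ [False]" "col_admissible d s"
    by (auto simp: col_admissible_snoc)
  then have "length d = length s" "True \<in> set d"
    by (auto simp: col_admissible_def)
  with c show "butlast c @ [False] = c" "butlast c \<in> {c. col_admissible c s}"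
    "F (col_update (butlast c) s @ [None]) = F (col_update c (s @ [None]))"
    by (simp_all add: col_update_snoc)
next
  fix c assume "c \<in> {c. col_admissible c s}"
  then show "c @ [False] \<in> {c. col_admissible c (s @ [None])}"
    by (simp add: col_admissible_snoc)
qed simp

text \<open>Three kinds of columns arise: an admissible column above a bottom 1 or a bottom 0, and
  the column whose only 1 is at the bottom.\<close>

lemma sum_col_admissible_snoc_Some:
  fixes F :: "nat option list \<Rightarrow> 'a::comm_monoid_add"
  shows "(\<Sum>c | col_admissible c (s @ [Some a]). F (col_update c (s @ [Some a]))) =
   (\<Sum>c | col_admissible c s. F (col_update c s @ [Some 0]) + F (col_update c s @ [None])) +
   F (s @ [Some (Suc a)])"
proof -
  let ?A = "{c. col_admissible c s}" and ?r = "replicate (length s) False @ [True]"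
  let ?F = "\<lambda>c. F (col_update c (s @ [Some a]))"
  have fin: "finite ?A"
    by (rule finite_col_admissible)
  have A: "length c = length s" "True \<in> set c" if "c \<in> ?A" for c
    using that by (auto simp: col_admissible_def)
  have "{c. col_admissible c (s @ [Some a])} =
      (\<lambda>c. c @ [True]) ` ?A \<union> (\<lambda>c. c @ [False]) ` ?A \<union> {?r}" (is "?L = ?R")
  proof (rule set_eqI)
    fix c show "c \<in> ?L \<longleftrightarrow> c \<in> ?R"
    proof (cases c rule: rev_cases)
      case Nil
      then show ?thesis
        by (auto simp: col_admissible_def)
    next
      case (snoc d x)
      then show ?thesis
        by (cases x) (auto simp: col_admissible_snoc)
    qed
  qed
  moreover have "((\<lambda>c. c @ [True]) ` ?A \<union> (\<lambda>c. c @ [False]) ` ?A) \<inter> {?r} = {}"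
    by (auto simp: col_admissible_def)
  moreover have "(\<lambda>c. c @ [True]) ` ?A \<inter> (\<lambda>c. c @ [False]) ` ?A = {}"
    by auto
  ultimately have "sum ?F {c. col_admissible c (s @ [Some a])} =
      sum ?F ((\<lambda>c. c @ [True]) ` ?A) + sum ?F ((\<lambda>c. c @ [False]) ` ?A) + ?F ?r"
    using fin by (simp only: sum.union_disjoint finite_UnI finite_imageI finite.intros) simp
  also have "sum ?F ((\<lambda>c. c @ [True]) ` ?A) = (\<Sum>c\<in>?A. F (col_update c s @ [Some 0]))"
    using A by (subst sum.reindex) (auto simp: inj_on_def col_update_snoc intro!: sum.cong)
  also have "sum ?F ((\<lambda>c. c @ [False]) ` ?A) = (\<Sum>c\<in>?A. F (col_update c s @ [None]))"
    using A by (subst sum.reindex) (auto simp: inj_on_def col_update_snoc intro!: sum.cong)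
  also have "?F ?r = F (s @ [Some (Suc a)])"
    by (simp add: col_update_snoc)
  finally show ?thesis
    by (simp add: sum.distrib)
qed

text \<open>
  With \<open>z = w + X\<close>, an unrestricted column topped in the \<open>m\<close>-th unrestricted row has weight
  \<open>Y = 1 + (Y - 1)\<close>. Choosing the term \<open>Y - 1\<close> freezes the \<open>m - 1\<close> unrestricted rows above it
  (each then counts \<open>X\<close> instead of \<open>z\<close>); \<open>state_poly\<close> sums over all choices, the lowest
  chosen column deciding what is frozen. Hence the value at \<open>w = 0\<close> in the recursion.
\<close>

fun state_step :: "'a::comm_ring_1 \<Rightarrow> 'a \<Rightarrow> 'a poly \<Rightarrow> nat option \<Rightarrow> 'a poly" where
  "state_step X Y p None = p"
| "state_step X Y p (Some a) = [:X, 1:] * (p + [:(Y ^ a - 1) * poly p 0:])"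

definition state_poly :: "'a::comm_ring_1 \<Rightarrow> 'a \<Rightarrow> nat option list \<Rightarrow> 'a poly" where
  "state_poly X Y s = foldl (state_step X Y) 1 s"

lemma state_poly_snoc [simp]:
  "state_poly X Y [] = 1"
  "state_poly X Y (s @ [y]) = state_step X Y (state_poly X Y s) y"
  by (simp_all add: state_poly_def)

text \<open>At 0 the factor \<open>[:X, 1:]\<close> becomes \<open>X\<close>, and adding
  \<open>(Y ^ a - 1)\<close> times the value at 0 multiplies that value by
  \<open>Y ^ a\<close>.\<close>

lemma poly_state_poly_0:
  "poly (state_poly X Y s) 0 =
     (\<Prod>i<length s. case s ! i of None \<Rightarrow> 1 | Some a \<Rightarrow> X * Y ^ a)"
proof (induction s rule: rev_induct)
  case (snoc y s)
  then show ?case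
    by (cases y) (simp_all add: nth_append algebra_simps)
qed simp

lemma poly_state_poly_row_state:
  assumes "permutation_tableau T"
  shows "poly (state_poly X Y (row_state T)) 0 = X ^ urr T * Y ^ urc T"
proof -
  have "poly (state_poly X Y (row_state T)) 0 =
      (\<Prod>i<length T. if row_free T i then X * Y ^ card (free_tops T i) else 1)"
    by (auto simp: poly_state_poly_0 row_state_def intro!: prod.cong)
  also have "\<dots> = (\<Prod>i | i < length T \<and> row_free T i. X * Y ^ card (free_tops T i))"
    by (rule prod.mono_neutral_cong_right) auto
  also have "\<dots> = X ^ urr T * Y ^ urc T"
    by (simp add: prod.distrib urr_eq urc_eq[OF assms] power_sum)
  finally show ?thesis .
qed

text \<open>The first summand is the weight after adding an empty row, so the left side collects all
  one-step growths. In the induction on the bottom row, a restricted row changes neither side; for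
  an unrestricted one, \<open>growth_op_mult\<close> matches the three kinds of columns.\<close>

lemma sum_state_poly_col_update:
  "[:X, 1:] * state_poly X Y s + (\<Sum>c | col_admissible c s. state_poly X Y (col_update c s)) =
   growth_op X Y (state_poly X Y s)"
proof (induction s rule: rev_induct)
  case Nil
  show ?case
    by (simp add: one_pCons growth_op_pCons)
next
  case (snoc y s)
  define f where "f = state_poly X Y s"
  define C where "C = (\<Sum>c | col_admissible c s. state_poly X Y (col_update c s))"
  have IH: "growth_op X Y f = [:X, 1:] * f + C"
    using snoc by (simp add: f_def C_def)
  show ?case
  proof (cases y)
    case None
    then show ?thesis
      using snoc by (simp add: sum_col_admissible_snoc_None)
  next
    case (Some a)
    define e where "e = poly f 0"
    have step_0: "state_step X Y p (Some 0) = [:X, 1:] * p" for p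
      by simp
    have const: "growth_op X Y [:d:] = [:d:] * [:X, 1:]" for d
      by (simp add: growth_op_pCons)
    have sm: "smult c r = [:c:] * r" for c and r :: "'a poly"
      by simp
    have con: "[:c * d:] = [:c:] * [:d:]" "[:c + d:] = [:c:] + [:d:]" "[:c - d:] = [:c:] - [:d:]"
      "[:1:] = 1" for c d :: 'a
      by (simp_all add: one_pCons)
    have X1: "[:X + 1, 1:] = [:X, 1:] + 1"
      by (simp add: one_pCons)
    \<comment> \<open>Now \<open>z\<close> stands for \<open>[:X, 1:]\<close>, \<open>w\<close> for
      the constant \<open>Y ^ a\<close>, and \<open>e\<close> for the value of \<open>f\<close> at
      0.\<close>
    have ring: "z * (z * (f + (w - 1) * e)) + (z * C + C + z * (f + (y * w - 1) * e)) =
        (z + 1) * (z * f + C + (w - 1) * e * z) + (y - 1) * (e + (w - 1) * e) * z"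
      for z y w e f C :: "'a poly"
      by (simp add: algebra_simps)
    have p0: "poly (f + [:(Y ^ a - 1) * e:]) 0 = e + (Y ^ a - 1) * e"
      by (simp add: e_def)
    have "growth_op X Y ([:X, 1:] * (f + [:(Y ^ a - 1) * e:])) =
        ([:X, 1:] + 1) * ([:X, 1:] * f + C + [:(Y ^ a - 1) * e:] * [:X, 1:]) +
        smult ((Y - 1) * (e + (Y ^ a - 1) * e)) [:X, 1:]"
      by (simp only: growth_op_mult growth_op_add const IH X1 p0)
    also have "\<dots> = [:X, 1:] * ([:X, 1:] * (f + [:(Y ^ a - 1) * e:])) +
        ([:X, 1:] * C + C + [:X, 1:] * (f + [:(Y * Y ^ a - 1) * e:]))"
      unfolding sm con by (rule ring[symmetric])
    also have "[:X, 1:] * C + C + [:X, 1:] * (f + [:(Y * Y ^ a - 1) * e:]) =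
        (\<Sum>c | col_admissible c (s @ [y]). state_poly X Y (col_update c (s @ [y])))"
      unfolding Some sum_col_admissible_snoc_Some state_poly_snoc step_0
      by (simp only: state_step.simps power_Suc sum.distrib sum_distrib_left C_def f_def e_def)
    finally show ?thesis
      by (simp add: Some f_def e_def)
  qed
qed

section \<open>Summation over all tableaux and comparison with the moments\<close>

lemma sum_state_poly_PT:
  "(\<Sum>T\<in>PT n. state_poly X Y (row_state T)) = (growth_op X Y ^^ n) 1"
proof (induction n)
  case 0
  have "PT 0 = {[]}"
    by (auto simp: PT_def num_rows_def num_cols_def permutation_tableau_def ferrers_shape_def
        has_zero_def)
  then show ?case
    by (simp add: row_state_def)
next
  case (Suc n)
  interpret module_hom smult smult "growth_op X Y"
    by (rule module_hom_growth_op)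
  have "state_poly X Y (row_state (T @ [[]])) +
      (\<Sum>c | col_admissible c (row_state T). state_poly X Y (row_state (add_col c T))) =
      growth_op X Y (state_poly X Y (row_state T))" if "T \<in> PT n" for T
  proof -
    have "(\<Sum>c | col_admissible c (row_state T). state_poly X Y (row_state (add_col c T))) =
        (\<Sum>c | col_admissible c (row_state T). state_poly X Y (col_update c (row_state T)))"
      using that
      by (intro sum.cong refl arg_cong[of _ _ "state_poly X Y"] row_state_add_col)
        (auto simp: PT_def col_admissible_def row_state_def)
    then show ?thesis
      using sum_state_poly_col_update[of X Y "row_state T"] by (simp add: row_state_snoc_Nil)
  qed
  then show ?case
    by (simp add: sum_PT_Suc sum flip: Suc.IH)
qed

text \<open>The first of the \<open>n + 1\<close> growth steps leads from \<open>1\<close> to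
  \<open>growth_basis X 0\<close>, and the other \<open>n\<close> give the moment. The factor
  \<open>X\<close> on the right is the value of \<open>growth_basis X 0\<close> at 0.\<close>

lemma sum_PT_eq_moment:
  fixes X Y :: "'a::comm_ring_1"
  shows "(\<Sum>T\<in>PT (Suc n). X ^ urr T * Y ^ urc T) =
    moment (\<lambda>k. 2 * of_nat k + X + Y) (\<lambda>k. (of_nat k + X) * (of_nat k - 1 + Y)) n * X"
proof -
  have "(\<Sum>T\<in>PT (Suc n). X ^ urr T * Y ^ urc T) =
      poly (\<Sum>T\<in>PT (Suc n). state_poly X Y (row_state T)) 0"
    unfolding poly_sum by (rule sum.cong) (auto simp: PT_def poly_state_poly_row_state)
  also have "\<dots> = poly ((growth_op X Y ^^ n) (growth_basis X 0)) 0"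
    by (simp add: sum_state_poly_PT funpow_swap1 growth_basis_def)
      (simp add: one_pCons growth_op_pCons)
  also have "\<dots> = moment (\<lambda>k. 2 * of_nat k + X + Y)
      (\<lambda>k. (of_nat k + X) * (of_nat k - 1 + Y)) n * X"
    using moment_functional_mult_monom[of "growth_op X Y" "growth_basis X"
        "\<lambda>k. 2 * of_nat k + X + Y" "\<lambda>k. (of_nat k + X) * (of_nat k - 1 + Y)" n 0]
    by (simp add: module_hom_growth_op growth_op_basis_0 growth_op_basis_Suc poly_growth_basis_0
        moment_def del: of_nat_Suc)
  finally show ?thesis .
qed

theorem theorem4p1:
  fixes X Y :: "'a::comm_ring_1 poly poly" and n :: nat
  assumes "X = [:[:0, 1:]:]" and "Y = [:0, 1:]"
  shows "moment (\<lambda>k. 2 * of_nat k + X + Y) (\<lambda>k. (of_nat k + X) * (of_nat k - 1 + Y)) n =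
    (\<Sum>T\<in>PT (n + 1). X ^ (urr T - 1) * Y ^ urc T)"
proof -
  \<comment> \<open>The coefficient ring may have zero divisors, but \<open>X\<close> is still
    cancellable: multiplying by it only shifts the coefficients of each inner polynomial.\<close>
  have cancel: "p = q" if "p * X = q * X" for p q
  proof (rule poly_eqI)
    fix i
    have "coeff (p * X) i = coeff (q * X) i"
      using that by simp
    then show "coeff p i = coeff q i"
      by (simp add: assms(1) mult.commute[of _ "[:[:0, 1:]:]"])
  qed
  have "(\<Sum>T\<in>PT (n + 1). X ^ (urr T - 1) * Y ^ urc T) * X =
      (\<Sum>T\<in>PT (Suc n). X ^ urr T * Y ^ urc T)"
    unfolding sum_distrib_right
  proof (rule sum.cong)
    fix T assume "T \<in> PT (Suc n)"
    then have "X ^ urr T = X ^ (urr T - 1) * X"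
      using urr_pos by (metis power_minus_mult Suc_le_eq One_nat_def)
    then show "X ^ (urr T - 1) * Y ^ urc T * X = X ^ urr T * Y ^ urc T"
      by (simp add: mult_ac)
  qed simp
  then have "(\<Sum>T\<in>PT (n + 1). X ^ (urr T - 1) * Y ^ urc T) * X =
      moment (\<lambda>k. 2 * of_nat k + X + Y) (\<lambda>k. (of_nat k + X) * (of_nat k - 1 + Y)) n * X"
    by (simp only: sum_PT_eq_moment)
  then show ?thesis
    by (rule cancel[symmetric])
qed

end
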